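(* Let $0<\alpha\le 1$, let $I\subseteq \mathbb{R}$ be an interval with interior $I^0$, and let $f: I^0\to \mathbb{R}^\alpha$ be such that $f\in D_\alpha(I^0)$ and $f^{(\alpha)}\in C_\alpha[a,b]$, where $a,b\in I^0$ with $a<b$. Then $$f\left(\frac{a+b}{2}\right)-\frac{\Gamma(1+\alpha)}{(b-a)^\alpha}\,{}_aI_b^{(\alpha)}f(x)=\frac{1}{(b-a)^\alpha}\,\frac{1}{\Gamma(1+\alpha)}\int_a^b S(x)f^{(\alpha)}(x)\,(dx)^\alpha ,$$ where $$S(x)=\begin{cases}(x-a)^\alpha, & x\in\left[a,\frac{a+b}{2}\right),\\ (x-b)^\alpha, & x\in\left[\frac{a+b}{2},b\right].\end{cases}$$
   Context: Conventions of local fractional calculus (Gao–Yang–Kang), for fixed $0<\alpha\le1$. The set $\mathbb{R}^\alpha$ of ($\alpha$-type) real line numbers is $\mathbb{R}^\alpha=\mathbb{Q}^\alpha\cup\mathbb{J}^\alpha$, where $\mathbb{Q}^\alpha=\{m^\alpha=(p/q)^\alpha: p,q\in\mathbb{Z}, q\ne0\}$ and $\mathbb{J}^\alpha=\{m^\alpha\neq(p/q)^\alpha: p,q\in\mathbb{Z},q\neq0\}$. That is, its elements are the symbols $x^\alpha$ with $x$ real (including negative $x$). The operations satisfy $a^\alpha+b^\alpha=(a+b)^\alpha=b^\alpha+a^\alpha$ and $a^\alpha b^\alpha=(ab)^\alpha=b^\alpha a^\alpha$, are associative and distributive, and have neutral elements $0^\alpha$ and $1^\alpha$. Expressions such as $(x-a)^\alpha$,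 $(x-b)^\alpha$, $(b-a)^\alpha$ denote elements of $\mathbb{R}^\alpha$ in this sense. Local fractional continuity: $f:\mathbb{R}\to\mathbb{R}^\alpha$ is local fractional continuous at $x_0$ if for every $\varepsilon>0$ there is $\delta>0$ such that $|f(x)-f(x_0)|<\varepsilon^\alpha$ whenever $|x-x_0|<\delta$. $C_\alpha$ of an interval denotes the functions that are local fractional continuous on that interval. Local fractional derivative of order $\alpha$ at $x_0$: $f^{(\alpha)}(x_0)=\lim_{x\to x_0}\frac{\Delta^\alpha(f(x)-f(x_0))}{(x-x_0)^\alpha}$, where $\Delta^\alpha(f(x)-f(x_0))\cong\Gamma(1+\alpha)(f(x)-f(x_0))$. $f\in D_\alpha(I^0)$ means that $f^{(\alpha)}(x)$ exists for every $x\in I^0$. Local fractional integral: ${}_aI_b^{(\alpha)}f(x)=\frac{1}{\Gamma(1+\alpha)}\int_a^b f(t)(dt)^\alpha=\frac{1}{\Gamma(1+\alpha)}\lim_{\Delta t\to0}\sum_{j=0}^{N-1}f(t_j)(\Delta t_j)^\alpha$, where $a=t_0<t_1<\cdots<t_N=b$ is a partition of $[a,b]$, $\Delta t_j=t_{j+1}-t_j$ and $\Delta t=\max_j\Delta t_j$. (It is introduced for $f\in C_\alpha[a,b]$; the integral of the piecewise-defined integrand $S f^{(\alpha)}$ over $[a,b]$ is the sum of the integrals over $[a,\frac{a+b}{2}]$ and $[\frac{a+b}{2},b]$ of $(x-a)^\alpha f^{(\alpha)}(x)$ and $(x-b)^\alpha f^{(\alpha)}(x)$ respectively.) Here $\Gamma$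 is Euler's Gamma function. *)

theory Defs
  imports "HOL-Analysis.Analysis"
begin

text \<open>
  Throughout, the order \<open>\<alpha>\<close> is fixed and \<open>apow x\<close> is the formal symbol \<open>x\<^sup>\<alpha>\<close>, one for every real
  \<open>x\<close> (also negative), so that \<open>ralpha\<close> is the set of \<open>\<alpha>\<close>-type real line numbers.  The addition is
  \<open>x\<^sup>\<alpha> + y\<^sup>\<alpha> = (x + y)\<^sup>\<alpha>\<close>; hence \<open>apow\<close> cannot be the ordinary real power, and it does not
  depend on the value of \<open>\<alpha>\<close>.  The order \<open>\<alpha>\<close> enters below through the factor \<open>\<Gamma>(1 + \<alpha>)\<close>.
\<close>

datatype ralpha = apow (base: real)

lemma base_inject: "base u = base v \<longleftrightarrow> u = v"
  by (metis ralpha.collapse)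

instantiation ralpha :: linordered_field
begin

definition zero_ralpha :: ralpha where "0 = apow 0"
definition one_ralpha :: ralpha where "1 = apow 1"
definition plus_ralpha :: "ralpha \<Rightarrow> ralpha \<Rightarrow> ralpha" where "u + v = apow (base u + base v)"
definition minus_ralpha :: "ralpha \<Rightarrow> ralpha \<Rightarrow> ralpha" where "u - v = apow (base u - base v)"
definition uminus_ralpha :: "ralpha \<Rightarrow> ralpha" where "- u = apow (- base u)"
definition times_ralpha :: "ralpha \<Rightarrow> ralpha \<Rightarrow> ralpha" where "u * v = apow (base u * base v)"
definition divide_ralpha :: "ralpha \<Rightarrow> ralpha \<Rightarrow> ralpha" where "u div v = apow (base u / base v)"
definition inverse_ralpha :: "ralpha \<Rightarrow> ralpha" where "inverse u = apow (inverse (base u))"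
definition less_eq_ralpha :: "ralpha \<Rightarrow> ralpha \<Rightarrow> bool" where "u \<le> v \<longleftrightarrow> base u \<le> base v"
definition less_ralpha :: "ralpha \<Rightarrow> ralpha \<Rightarrow> bool" where "u < v \<longleftrightarrow> base u < base v"
definition abs_ralpha :: "ralpha \<Rightarrow> ralpha" where "\<bar>u\<bar> = apow \<bar>base u\<bar>"
definition sgn_ralpha :: "ralpha \<Rightarrow> ralpha" where "sgn u = apow (sgn (base u))"

lemmas ralpha_defs =
  zero_ralpha_def one_ralpha_def plus_ralpha_def minus_ralpha_def uminus_ralpha_def
  times_ralpha_def divide_ralpha_def inverse_ralpha_def less_eq_ralpha_def less_ralpha_def
  abs_ralpha_def sgn_ralpha_def

instance
  by standard
    (auto simp: ralpha_defs base_inject[symmetric] algebra_simps divide_inverse abs_if sgn_if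
       mult_strict_left_mono)

end

text \<open>
  A real number acts on \<open>ralpha\<close> by \<open>c \<cdot> x\<^sup>\<alpha> = (c x)\<^sup>\<alpha>\<close>, the scalar multiplication compatible with the
  addition (so that \<open>2 \<cdot> u = u + u\<close>).  This is how the real factor \<open>\<Gamma>(1 + \<alpha>)\<close> is applied.  The
  topology is the one of the metric \<open>\<bar>x - y\<bar>\<close> on bases; equivalently its neighbourhoods are given
  by \<open>\<bar>u - v\<bar> < \<epsilon>\<^sup>\<alpha>\<close>.
\<close>

instantiation ralpha :: real_normed_field
begin

definition scaleR_ralpha :: "real \<Rightarrow> ralpha \<Rightarrow> ralpha" where "c *\<^sub>R u = apow (c * base u)"
definition norm_ralpha :: "ralpha \<Rightarrow> real" where "norm u = \<bar>base u\<bar>"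
definition dist_ralpha :: "ralpha \<Rightarrow> ralpha \<Rightarrow> real" where "dist u v = \<bar>base u - base v\<bar>"
definition uniformity_ralpha_def:
  "(uniformity :: (ralpha \<times> ralpha) filter) = (INF e\<in>{0 <..}. principal {(u, v). dist u v < e})"
definition open_ralpha_def:
  "open (U :: ralpha set) \<longleftrightarrow> (\<forall>u\<in>U. eventually (\<lambda>(u', v). u' = u \<longrightarrow> v \<in> U) uniformity)"

instance
proof
  show "uniformity = (INF e\<in>{0 <..}. principal {(u::ralpha, v). dist u v < e})"
    by (rule uniformity_ralpha_def)
  show "open U \<longleftrightarrow> (\<forall>u\<in>U. eventually (\<lambda>(u', v). u' = u \<longrightarrow> v \<in> U) uniformity)" for U :: "ralpha set"
    by (rule open_ralpha_def)
qed (auto simp: ralpha_defs scaleR_ralpha_def norm_ralpha_def dist_ralpha_def base_inject[symmetric]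
       algebra_simps abs_mult sgn_if divide_inverse)

end

definition lf_cont_on :: "real set \<Rightarrow> (real \<Rightarrow> ralpha) \<Rightarrow> bool" where
  "lf_cont_on A f \<longleftrightarrow>
     (\<forall>x\<^sub>0\<in>A. \<forall>\<epsilon>>0. \<exists>\<delta>>0. \<forall>x\<in>A. \<bar>x - x\<^sub>0\<bar> < \<delta> \<longrightarrow> \<bar>f x - f x\<^sub>0\<bar> < apow \<epsilon>)"

definition has_lf_deriv :: "real \<Rightarrow> (real \<Rightarrow> ralpha) \<Rightarrow> ralpha \<Rightarrow> real \<Rightarrow> bool" where
  "has_lf_deriv \<alpha> f D x\<^sub>0 \<longleftrightarrow>
     ((\<lambda>x. (Gamma (1 + \<alpha>) *\<^sub>R (f x - f x\<^sub>0)) / apow (x - x\<^sub>0)) \<longlongrightarrow> D) (at x\<^sub>0)"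

definition lf_deriv :: "real \<Rightarrow> (real \<Rightarrow> ralpha) \<Rightarrow> real \<Rightarrow> ralpha" where
  "lf_deriv \<alpha> f x\<^sub>0 = (THE D. has_lf_deriv \<alpha> f D x\<^sub>0)"

definition lf_differentiable_on :: "real \<Rightarrow> real set \<Rightarrow> (real \<Rightarrow> ralpha) \<Rightarrow> bool" where
  "lf_differentiable_on \<alpha> A f \<longleftrightarrow> (\<forall>x\<in>A. \<exists>D. has_lf_deriv \<alpha> f D x)"

definition is_partition :: "real \<Rightarrow> real \<Rightarrow> nat \<Rightarrow> (nat \<Rightarrow> real) \<Rightarrow> bool" where
  "is_partition a b N t \<longleftrightarrow> t 0 = a \<and> t N = b \<and> (\<forall>j<N. t j < t (Suc j))"

definition lf_sum :: "(real \<Rightarrow> ralpha) \<Rightarrow> nat \<Rightarrow> (nat \<Rightarrow> real) \<Rightarrow> ralpha" where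
  "lf_sum f N t = (\<Sum>j<N. f (t j) * apow (t (Suc j) - t j))"

text \<open>\<open>has_lf_limit f a b L\<close>: the unnormalised integral of \<open>f(t) (dt)\<^sup>\<alpha>\<close> over \<open>[a, b]\<close> is \<open>L\<close>.\<close>

definition has_lf_limit :: "(real \<Rightarrow> ralpha) \<Rightarrow> real \<Rightarrow> real \<Rightarrow> ralpha \<Rightarrow> bool" where
  "has_lf_limit f a b L \<longleftrightarrow>
     (\<forall>\<epsilon>>0. \<exists>\<delta>>0. \<forall>N t. is_partition a b N t \<and> (\<forall>j<N. t (Suc j) - t j < \<delta>) \<longrightarrow>
        \<bar>lf_sum f N t - L\<bar> < apow \<epsilon>)"

definition lf_integral :: "real \<Rightarrow> real \<Rightarrow> real \<Rightarrow> (real \<Rightarrow> ralpha) \<Rightarrow> ralpha" where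
  "lf_integral \<alpha> a b f = (1 / Gamma (1 + \<alpha>)) *\<^sub>R (THE L. has_lf_limit f a b L)"

text \<open>
  The function \<open>S\<close> has a jump at the midpoint, so \<open>S f\<^sup>(\<^sup>\<alpha>\<^sup>)\<close> is only piecewise continuous; the limit
  of Riemann sums still exists for it and is the sum of the integrals over the two halves.
\<close>

definition S_kernel :: "real \<Rightarrow> real \<Rightarrow> real \<Rightarrow> ralpha" where
  "S_kernel a b x = (if x < (a + b) / 2 then apow (x - a) else apow (x - b))"

end

theory Submission
  imports Defs
begin

text \<open>
  The map \<open>base\<close> is an isometric field isomorphism of the \<open>\<alpha>\<close>-type line numbers onto the reals.
  Put \<open>g = base \<circ> f\<close>, \<open>m = (a + b) / 2\<close> and \<open>\<Gamma> = \<Gamma>(1 + \<alpha>)\<close>.  Under this isomorphism the local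
  fractional derivative of \<open>f\<close> becomes \<open>\<Gamma> g'\<close> (lemma \<open>has_lf_deriv_imp_DERIV_base\<close>), and the local
  fractional integral becomes the ordinary integral divided by \<open>\<Gamma>\<close> (lemma \<open>lf_integral_eq\<close>).  The
  factors of \<open>\<Gamma>\<close> therefore cancel on both sides, and what has to be shown, after multiplying by
  \<open>b - a\<close>, is the classical identity
  \<open>\<integral>\<^sub>a\<^sup>m (x - a) g'(x) dx + \<integral>\<^sub>m\<^sup>b (x - b) g'(x) dx = (b - a) g(m) - \<integral>\<^sub>a\<^sup>b g(x) dx\<close>.
  It follows by integrating by parts on each half: the boundary terms at \<open>a\<close> and \<open>b\<close> vanish and
  those at \<open>m\<close> add up to \<open>(m - a) g(m) + (b - m) g(m)\<close> (lemma \<open>midpoint_identity\<close>).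

  The analytic work lies in the local fractional integral, which is given by a limit of left Riemann
  sums over all partitions of small mesh.  Those limits must be shown to exist and to equal
  Henstock-Kurzweil integrals, also for the integrand \<open>S f\<^sup>(\<^sup>\<alpha>\<^sup>)\<close>, which may jump at \<open>m\<close>.  A function
  with one jump is a continuous function plus a multiple of the step function at \<open>m\<close>, and left
  sums are linear in the integrand, so the cases of a continuous function and of a step function
  suffice (lemma \<open>left_sum_piecewise_tendsto\<close>).
\<close>

section \<open>Riemann sums along partitions of vanishing mesh\<close>

text \<open>
  The limit for mesh tending to zero is phrased as a limit along a filter, so that linearity and
  uniqueness of Riemann limits are instances of the general facts on filter limits.
\<close>

definition fine_partitions :: "real \<Rightarrow> real \<Rightarrow> (nat \<times> (nat \<Rightarrow> real)) filter" where
  "fine_partitions a b =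
     (INF \<delta>\<in>{0<..}. principal {(N, t). is_partition a b N t \<and> (\<forall>j<N. t (Suc j) - t j < \<delta>)})"

definition left_sum :: "(real \<Rightarrow> real) \<Rightarrow> nat \<times> (nat \<Rightarrow> real) \<Rightarrow> real" where
  "left_sum g = (\<lambda>(N, t). \<Sum>j<N. g (t j) * (t (Suc j) - t j))"

lemma eventually_fine_partitions:
  "eventually P (fine_partitions a b) \<longleftrightarrow>
     (\<exists>\<delta>>0. \<forall>N t. is_partition a b N t \<and> (\<forall>j<N. t (Suc j) - t j < \<delta>) \<longrightarrow> P (N, t))"
proof -
  let ?S = "\<lambda>\<delta>. {(N, t). is_partition a b N t \<and> (\<forall>j<N. t (Suc j) - t j < \<delta>)}"
  have "eventually P (fine_partitions a b) \<longleftrightarrow> (\<exists>\<delta>\<in>{0<..}. eventually P (principal (?S \<delta>)))"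
    unfolding fine_partitions_def
  proof (rule eventually_INF_base)
    fix d e :: real assume "d \<in> {0<..}" "e \<in> {0<..}"
    then show "\<exists>x\<in>{0<..}. principal (?S x) \<le> inf (principal (?S d)) (principal (?S e))"
      by (intro bexI[of _ "min d e"]) auto
  qed auto
  also have "\<dots> \<longleftrightarrow> (\<exists>\<delta>>0. \<forall>N t. is_partition a b N t \<and> (\<forall>j<N. t (Suc j) - t j < \<delta>) \<longrightarrow> P (N, t))"
    by (auto simp: eventually_principal)
  finally show ?thesis .
qed

text \<open>
  Equidistant partitions are arbitrarily fine.  This is what makes the limit of Riemann sums unique.
\<close>

lemma fine_partitions_nontrivial:
  assumes "a < b"
  shows "fine_partitions a b \<noteq> bot"
proof
  assume "fine_partitions a b = bot"
  then have "eventually (\<lambda>_. False) (fine_partitions a b)" by simp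
  then obtain \<delta> where "\<delta> > 0"
    and no: "\<And>N t. \<not> (is_partition a b N t \<and> (\<forall>j<N. t (Suc j) - t j < \<delta>))"
    unfolding eventually_fine_partitions by blast
  obtain N :: nat where N: "(b - a) / \<delta> < real N"
    using reals_Archimedean2 by blast
  have "0 < (b - a) / \<delta>" using assms \<open>\<delta> > 0\<close> by simp
  with N have "N > 0" by (cases N) auto
  define h where "h = (b - a) / N"
  have "0 < h" "h < \<delta>"
    using N \<open>N > 0\<close> \<open>\<delta> > 0\<close> assms by (auto simp: h_def field_simps)
  moreover have "real N * h = b - a" using \<open>N > 0\<close> by (simp add: h_def)
  ultimately show False
    using no[of N "\<lambda>j. a + j * h"] by (auto simp: is_partition_def algebra_simps)
qed

lemma partition_mono:
  assumes "is_partition a b N t" "i \<le> j" "j \<le> N"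
  shows "t i \<le> t j"
  using assms(2,3)
proof (induction j rule: dec_induct)
  case (step n)
  then have "t n < t (Suc n)" using assms(1) by (auto simp: is_partition_def)
  with step show ?case by simp
qed simp

lemma partition_in_interval:
  assumes "is_partition a b N t" "j \<le> N"
  shows "t j \<in> {a..b}"
  using partition_mono[OF assms(1), of 0 j] partition_mono[OF assms(1), of j N] assms
  by (auto simp: is_partition_def)

lemma left_sum_add: "left_sum (\<lambda>x. g x + h x) p = left_sum g p + left_sum h p"
  by (simp add: left_sum_def split_beta distrib_right sum.distrib)

lemma left_sum_cmult: "left_sum (\<lambda>x. c * g x) p = c * left_sum g p"
  by (simp add: left_sum_def split_beta sum_distrib_left mult.assoc)

section \<open>Convergence for piecewise continuous integrands\<close>

text \<open>
  On an interval of a partition finer than the modulus of uniform continuity for \<open>\<eta>\<close>, the summand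
  differs from the integral by at most \<open>\<eta>\<close> times the length; the errors add up to at most
  \<open>\<eta> (b - a)\<close>.  Writing the integrals as increments of an antiderivative lets them telescope.
\<close>

lemma left_sum_continuous_tendsto_integral:
  assumes "a < b" and cont: "continuous_on {a..b} g"
  shows "(left_sum g \<longlongrightarrow> integral {a..b} g) (fine_partitions a b)"
proof (rule tendstoI)
  fix \<epsilon> :: real assume "\<epsilon> > 0"
  define \<eta> where "\<eta> = \<epsilon> / (2 * (b - a))"
  have "\<eta> > 0" using \<open>\<epsilon> > 0\<close> \<open>a < b\<close> by (simp add: \<eta>_def)
  obtain F where F: "\<And>x. x \<in> {a..b} \<Longrightarrow> (F has_vector_derivative g x) (at x within {a..b})"
    using antiderivative_continuous[OF cont] by metis
  have int: "(g has_integral (F v - F u)) {u..v}" if "a \<le> u" "u \<le> v" "v \<le> b" for u v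
  proof (rule fundamental_theorem_of_calculus)
    show "(F has_vector_derivative g x) (at x within {u..v})" if "x \<in> {u..v}" for x
      using that \<open>a \<le> u\<close> \<open>v \<le> b\<close> by (intro has_vector_derivative_within_subset[OF F]) auto
  qed fact
  have "uniformly_continuous_on {a..b} g"
    using cont compact_uniformly_continuous by blast
  then obtain \<delta> where "\<delta> > 0"
    and \<delta>: "\<And>x y. x \<in> {a..b} \<Longrightarrow> y \<in> {a..b} \<Longrightarrow> dist y x < \<delta> \<Longrightarrow> dist (g y) (g x) < \<eta>"
    unfolding uniformly_continuous_on_def using \<open>\<eta> > 0\<close> by metis
  have "dist (left_sum g (N, t)) (integral {a..b} g) < \<epsilon>"
    if P: "is_partition a b N t" and mesh: "\<forall>j<N. t (Suc j) - t j < \<delta>" for N t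
  proof -
    have t: "t 0 = a" "t N = b" using P by (auto simp: is_partition_def)
    have local: "\<bar>g (t j) * (t (Suc j) - t j) - (F (t (Suc j)) - F (t j))\<bar> \<le> \<eta> * (t (Suc j) - t j)"
      if "j < N" for j
    proof -
      let ?u = "t j" and ?v = "t (Suc j)"
      have uv: "a \<le> ?u" "?u < ?v" "?v \<le> b" "?v - ?u < \<delta>"
        using partition_in_interval[OF P, of j] partition_in_interval[OF P, of "Suc j"]
          P mesh that by (auto simp: is_partition_def)
      have "((\<lambda>x. g ?u - g x) has_integral (g ?u * (?v - ?u) - (F ?v - F ?u))) {?u..?v}"
        using has_integral_diff[OF has_integral_const_real[of "g ?u" ?u ?v] int[of ?u ?v]] uv
        by (simp add: mult.commute)
      moreover have "norm (g ?u - g x) \<le> \<eta>" if "x \<in> {?u..?v}" for x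
        using \<delta>[of x ?u] that uv by (auto simp: dist_real_def)
      ultimately have "norm (g ?u * (?v - ?u) - (F ?v - F ?u)) \<le> \<eta> * measure lborel {?u..?v}"
        using \<open>\<eta> > 0\<close> by (intro has_integral_bound_real[where f="\<lambda>x. g ?u - g x"]) auto
      then show ?thesis using uv by simp
    qed
    have "integral {a..b} g = F b - F a"
      using int[of a b] \<open>a < b\<close> by (simp add: integral_unique)
    also have "\<dots> = (\<Sum>j<N. F (t (Suc j)) - F (t j))"
      by (simp add: sum_lessThan_telescope[of "\<lambda>j. F (t j)"] t)
    finally have "left_sum g (N, t) - integral {a..b} g =
        (\<Sum>j<N. g (t j) * (t (Suc j) - t j) - (F (t (Suc j)) - F (t j)))"
      by (simp add: left_sum_def sum_subtractf)
    also have "\<bar>\<dots>\<bar> \<le> (\<Sum>j<N. \<eta> * (t (Suc j) - t j))"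
      using local by (intro order_trans[OF sum_abs] sum_mono) auto
    also have "\<dots> = \<eta> * (b - a)"
      by (simp add: sum_distrib_left[symmetric] sum_lessThan_telescope t)
    also have "\<dots> < \<epsilon>" using \<open>\<epsilon> > 0\<close> \<open>a < b\<close> by (simp add: \<eta>_def divide_less_eq)
    finally show ?thesis by (simp add: dist_real_def)
  qed
  then show "\<forall>\<^sub>F p in fine_partitions a b. dist (left_sum g p) (integral {a..b} g) < \<epsilon>"
    unfolding eventually_fine_partitions using \<open>\<delta> > 0\<close> by blast
qed

text \<open>
  The left sum of the step function is the total length of the partition intervals whose left end
  is at least \<open>m\<close>; they cover \<open>[m, b]\<close> except for a piece shorter than the mesh.
\<close>

lemma left_sum_step_tendsto:
  assumes "a \<le> m" "m \<le> b"
  shows "(left_sum (\<lambda>x. if x < m then 0 else 1) \<longlongrightarrow> b - m) (fine_partitions a b)"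
proof (rule tendstoI)
  fix \<epsilon> :: real assume "\<epsilon> > 0"
  have "dist (left_sum (\<lambda>x. if x < m then 0 else 1) (N, t)) (b - m) < \<epsilon>"
    if P: "is_partition a b N t" and mesh: "\<forall>j<N. t (Suc j) - t j < \<epsilon> / 2" for N t
  proof -
    define s where "s n = (\<Sum>j<n. (if t j < m then 0 else 1) * (t (Suc j) - t j))" for n
    \<comment> \<open>The one interval straddling \<open>m\<close> contributes nothing, so \<open>s n\<close> may fall short of
      \<open>t n - m\<close> by at most its length; all later intervals are counted exactly.\<close>
    have "(t n < m \<longrightarrow> s n = 0) \<and> (m \<le> t n \<longrightarrow> t n - m - \<epsilon> / 2 \<le> s n \<and> s n \<le> t n - m)"
      if "n \<le> N" for n
      using that
    proof (induction n)
      case 0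
      then show ?case using P \<open>a \<le> m\<close> \<open>\<epsilon> > 0\<close> by (auto simp: s_def is_partition_def)
    next
      case (Suc n)
      have "t n < t (Suc n)" "t (Suc n) - t n < \<epsilon> / 2"
        using P mesh Suc.prems by (auto simp: is_partition_def)
      moreover have "s (Suc n) = s n + (if t n < m then 0 else t (Suc n) - t n)"
        by (simp add: s_def)
      moreover have "t n < m \<longrightarrow> s n = 0"
          "m \<le> t n \<longrightarrow> t n - m - \<epsilon> / 2 \<le> s n \<and> s n \<le> t n - m"
        using Suc by auto
      ultimately show ?case by (auto split: if_splits)
    qed
    from this[of N] have "\<bar>s N - (b - m)\<bar> \<le> \<epsilon> / 2"
      using P \<open>m \<le> b\<close> \<open>\<epsilon> > 0\<close> by (auto simp: is_partition_def)
    then show ?thesis using \<open>\<epsilon> > 0\<close> by (simp add: left_sum_def s_def dist_real_def)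
  qed
  then show "\<forall>\<^sub>F p in fine_partitions a b.
      dist (left_sum (\<lambda>x. if x < m then 0 else 1) p) (b - m) < \<epsilon>"
    unfolding eventually_fine_partitions using \<open>\<epsilon> > 0\<close> by (meson half_gt_zero)
qed

text \<open>
  Extending \<open>g\<close> to the right and \<open>h\<close> to the left of \<open>m\<close> by constants gives continuous functions on
  all of \<open>[a, b]\<close>.  With the second one shifted to vanish at \<open>m\<close>, their sum is \<open>g\<close> before \<open>m\<close> and
  \<open>h - h(m) + g(m)\<close> after it, so it differs from the piecewise function by \<open>h(m) - g(m)\<close> times the
  step function.
\<close>

lemma left_sum_piecewise_tendsto:
  assumes "a < m" "m < b"
    and cont1: "continuous_on {a..m} g" and cont2: "continuous_on {m..b} h"
  shows "(left_sum (\<lambda>x. if x < m then g x else h x) \<longlongrightarrow> integral {a..m} g + integral {m..b} h)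
           (fine_partitions a b)"
proof -
  let ?g = "\<lambda>x. g (min x m)" and ?h = "\<lambda>x. h (max x m) - h m"
  let ?step = "\<lambda>x. if x < m then 0 else 1 :: real"
  have cg: "continuous_on {a..b} ?g"
    using assms by (intro continuous_on_compose2[OF cont1] continuous_intros) auto
  have ch: "continuous_on {a..b} ?h"
    using assms by (intro continuous_intros continuous_on_compose2[OF cont2]) auto
  have "integral {a..b} ?g = integral {a..m} ?g + integral {m..b} ?g"
    using assms by (intro Henstock_Kurzweil_Integration.integral_combine[symmetric]
        integrable_continuous_real cg) auto
  also have "integral {a..m} ?g = integral {a..m} g"
    by (rule integral_cong) auto
  also have "integral {m..b} ?g = integral {m..b} (\<lambda>x. g m)"
    by (rule integral_cong) auto
  finally have ig: "integral {a..b} ?g = integral {a..m} g + (b - m) * g m"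
    using assms by simp
  have "integral {a..b} ?h = integral {a..m} ?h + integral {m..b} ?h"
    using assms by (intro Henstock_Kurzweil_Integration.integral_combine[symmetric]
        integrable_continuous_real ch) auto
  also have "integral {a..m} ?h = integral {a..m} (\<lambda>x. 0)"
    by (rule integral_cong) auto
  also have "integral {m..b} ?h = integral {m..b} (\<lambda>x. h x - h m)"
    by (rule integral_cong) auto
  also have "\<dots> = integral {m..b} h - (b - m) * h m"
    using assms by (subst integral_diff) (auto intro: integrable_continuous_real)
  finally have ih: "integral {a..b} ?h = integral {m..b} h - (b - m) * h m"
    by simp
  have "((\<lambda>p. left_sum ?g p + left_sum ?h p + (h m - g m) * left_sum ?step p)
      \<longlongrightarrow> integral {a..b} ?g + integral {a..b} ?h + (h m - g m) * (b - m)) (fine_partitions a b)"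
    using assms
    by (intro tendsto_intros left_sum_continuous_tendsto_integral cg ch left_sum_step_tendsto) auto
  moreover have "integral {a..b} ?g + integral {a..b} ?h + (h m - g m) * (b - m) =
      integral {a..m} g + integral {m..b} h"
    by (simp add: ig ih algebra_simps)
  moreover have "left_sum (\<lambda>x. if x < m then g x else h x) =
      (\<lambda>p. left_sum ?g p + left_sum ?h p + (h m - g m) * left_sum ?step p)"
  proof (rule ext)
    fix p
    have "(\<lambda>x. if x < m then g x else h x) = (\<lambda>x. (?g x + ?h x) + (h m - g m) * ?step x)"
      by (rule ext) (auto simp: min_def max_def)
    then show "left_sum (\<lambda>x. if x < m then g x else h x) p =
        left_sum ?g p + left_sum ?h p + (h m - g m) * left_sum ?step p"
      by (simp only: left_sum_add left_sum_cmult)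
  qed
  ultimately show ?thesis by simp
qed

section \<open>Passage from line numbers to real numbers\<close>

lemma base_lf_sum: "base (lf_sum f N t) = left_sum (\<lambda>x. base (f x)) (N, t)"
proof -
  have "base (\<Sum>j\<in>A. u j) = (\<Sum>j\<in>A. base (u j))" for A :: "nat set" and u
    by (induction A rule: infinite_finite_induct) (auto simp: ralpha_defs)
  then show ?thesis by (simp add: lf_sum_def left_sum_def ralpha_defs)
qed

lemma has_lf_limit_iff:
  "has_lf_limit f a b L \<longleftrightarrow> (left_sum (\<lambda>x. base (f x)) \<longlongrightarrow> base L) (fine_partitions a b)"
proof -
  have "has_lf_limit f a b L \<longleftrightarrow> (\<forall>\<epsilon>>0. eventually
      (\<lambda>p. dist (left_sum (\<lambda>x. base (f x)) p) (base L) < base \<epsilon>) (fine_partitions a b))"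
    by (simp add: has_lf_limit_def eventually_fine_partitions base_lf_sum[symmetric]
        dist_real_def ralpha_defs)
      (metis ralpha.sel)
  also have "\<dots> \<longleftrightarrow> (left_sum (\<lambda>x. base (f x)) \<longlongrightarrow> base L) (fine_partitions a b)"
    by (auto simp: tendsto_iff ralpha_defs) (metis ralpha.sel)
  finally show ?thesis .
qed

text \<open>
  The definite description in the local fractional integral is resolved by uniqueness of the limit.
\<close>

lemma lf_integral_eq:
  assumes "a < b" and lim: "(left_sum (\<lambda>x. base (f x)) \<longlongrightarrow> L) (fine_partitions a b)"
  shows "lf_integral \<alpha> a b f = apow (L / Gamma (1 + \<alpha>))"
proof -
  have "(THE L. has_lf_limit f a b L) = apow L"
  proof (rule the_equality)
    show "has_lf_limit f a b (apow L)" using lim by (simp add: has_lf_limit_iff)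
    show "M = apow L" if "has_lf_limit f a b M" for M
      using tendsto_unique[OF fine_partitions_nontrivial[OF \<open>a < b\<close>] _ lim] that
      by (auto simp: has_lf_limit_iff base_inject[symmetric])
  qed
  then show ?thesis by (simp add: lf_integral_def scaleR_ralpha_def)
qed

lemma lf_cont_on_imp_continuous_on_base:
  assumes "lf_cont_on A f"
  shows "continuous_on A (\<lambda>x. base (f x))"
  unfolding continuous_on_iff
proof (intro ballI allI impI)
  fix x e :: real assume "x \<in> A" "0 < e"
  then have "apow e > 0" by (simp add: ralpha_defs)
  with assms \<open>x \<in> A\<close> \<open>0 < e\<close> show "\<exists>d>0. \<forall>x'\<in>A. dist x' x < d \<longrightarrow> dist (base (f x')) (base (f x)) < e"
    by (fastforce simp: lf_cont_on_def dist_real_def ralpha_defs)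
qed

text \<open>
  The difference quotient of the local fractional derivative is \<open>\<Gamma>(1 + \<alpha>)\<close> times the ordinary one.
\<close>

lemma has_lf_deriv_imp_DERIV_base:
  assumes "has_lf_deriv \<alpha> f D x" and "Gamma (1 + \<alpha>) \<noteq> 0"
  shows "((\<lambda>y. base (f y)) has_real_derivative base D / Gamma (1 + \<alpha>)) (at x)"
proof -
  let ?q = "\<lambda>y. (Gamma (1 + \<alpha>) *\<^sub>R (f y - f x)) / apow (y - x)"
  have "((\<lambda>y. base (?q y)) \<longlongrightarrow> base D) (at x)"
    using assms(1) by (simp add: has_lf_deriv_def tendsto_iff dist_ralpha_def dist_real_def)
  then have "((\<lambda>y. base (?q y) / Gamma (1 + \<alpha>)) \<longlongrightarrow> base D / Gamma (1 + \<alpha>)) (at x)"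
    using assms(2) by (intro tendsto_intros)
  then show ?thesis
    using assms(2) by (simp add: has_field_derivative_iff ralpha_defs scaleR_ralpha_def)
qed

lemma has_lf_deriv_lf_deriv:
  assumes "has_lf_deriv \<alpha> f D x"
  shows "has_lf_deriv \<alpha> f (lf_deriv \<alpha> f x) x"
proof -
  have "lf_deriv \<alpha> f x = D"
    unfolding lf_deriv_def using assms
    by (auto simp: has_lf_deriv_def intro: the_equality tendsto_unique[OF at_neq_bot])
  with assms show ?thesis by simp
qed

section \<open>Integration by parts on the two halves\<close>

text \<open>
  This is integration by parts with \<open>x - e\<close> as antiderivative of \<open>1\<close>: the function \<open>(x - e) g(x)\<close>
  has the derivative \<open>g(x) + (x - e) g'(x)\<close>.
\<close>

lemma integral_shift_times_derivative:
  fixes g g' :: "real \<Rightarrow> real"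
  assumes "c \<le> d" and deriv: "\<And>x. x \<in> {c..d} \<Longrightarrow> (g has_real_derivative g' x) (at x)"
    and cont: "continuous_on {c..d} g'"
  shows "integral {c..d} (\<lambda>x. (x - e) * g' x) = (d - e) * g d - (c - e) * g c - integral {c..d} g"
proof -
  have g: "continuous_on {c..d} g"
    by (rule continuous_at_imp_continuous_on) (use deriv DERIV_isCont in blast)
  have "((\<lambda>x. g x + (x - e) * g' x) has_integral ((d - e) * g d - (c - e) * g c)) {c..d}"
  proof (rule fundamental_theorem_of_calculus[OF \<open>c \<le> d\<close>])
    fix x assume "x \<in> {c..d}"
    then have "((\<lambda>x. (x - e) * g x) has_real_derivative g x + (x - e) * g' x) (at x)"
      using deriv[of x] by (auto intro!: derivative_eq_intros)
    then show "((\<lambda>x. (x - e) * g x) has_vector_derivative g x + (x - e) * g' x) (at x within {c..d})"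
      using has_field_derivative_at_within has_real_derivative_iff_has_vector_derivative by blast
  qed
  from has_integral_diff[OF this integrable_integral[OF integrable_continuous_real[OF g]]]
  show ?thesis by (simp add: integral_unique)
qed

text \<open>
  Choosing the shift \<open>a\<close> on the left part and \<open>b\<close> on the right part removes the boundary terms at
  the outer endpoints, so that only the value at \<open>m\<close> survives.
\<close>

lemma midpoint_identity:
  fixes g g' :: "real \<Rightarrow> real"
  assumes "a \<le> m" "m \<le> b" and deriv: "\<And>x. x \<in> {a..b} \<Longrightarrow> (g has_real_derivative g' x) (at x)"
    and cont: "continuous_on {a..b} g'"
  shows "integral {a..m} (\<lambda>x. (x - a) * g' x) + integral {m..b} (\<lambda>x. (x - b) * g' x) =
         (b - a) * g m - integral {a..b} g"
proof -
  have "continuous_on {a..b} g"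
    by (rule continuous_at_imp_continuous_on) (use deriv DERIV_isCont in blast)
  then have split: "integral {a..m} g + integral {m..b} g = integral {a..b} g"
    using assms by (intro Henstock_Kurzweil_Integration.integral_combine integrable_continuous_real)
  have "continuous_on {a..m} g'" "continuous_on {m..b} g'"
    using assms by (auto intro: continuous_on_subset[OF cont])
  then have
    "integral {a..m} (\<lambda>x. (x - a) * g' x) = (m - a) * g m - integral {a..m} g"
    "integral {m..b} (\<lambda>x. (x - b) * g' x) = (b - m) * g m - integral {m..b} g"
    using assms integral_shift_times_derivative[of a m g g' a]
      integral_shift_times_derivative[of m b g g' b]
    by (auto simp: left_diff_distrib)
  with split show ?thesis by (simp add: algebra_simps)
qed

theorem theorem2:
  fixes \<alpha> a b :: real and I :: "real set" and f :: "real \<Rightarrow> ralpha"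
  assumes "0 < \<alpha>" and "\<alpha> \<le> 1"
    and "is_interval I"
    and "a \<in> interior I" and "b \<in> interior I" and "a < b"
    and "lf_differentiable_on \<alpha> (interior I) f"
    and "lf_cont_on {a..b} (lf_deriv \<alpha> f)"
  shows "f ((a + b) / 2) - (of_real (Gamma (1 + \<alpha>)) / apow (b - a)) * lf_integral \<alpha> a b f =
         (1 / apow (b - a)) * lf_integral \<alpha> a b (\<lambda>x. S_kernel a b x * lf_deriv \<alpha> f x)"
proof -
  define G m where "G = Gamma (1 + \<alpha>)" and "m = (a + b) / 2"
  define g g' where "g x = base (f x)" and "g' x = base (lf_deriv \<alpha> f x)" for x
  have "G > 0" using \<open>0 < \<alpha>\<close> by (simp add: G_def Gamma_real_pos)
  have m: "a < m" "m < b" using \<open>a < b\<close> by (auto simp: m_def)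
  have "is_interval (interior I)"
    using \<open>is_interval I\<close> by (simp add: is_interval_convex_1)
  then have sub: "{a..b} \<subseteq> interior I"
    using assms(4,5) by (meson atLeastAtMost_iff mem_is_interval_1_I subsetI)
  have deriv: "(g has_real_derivative g' x / G) (at x)" if "x \<in> {a..b}" for x
    using that sub assms(7) \<open>G > 0\<close> unfolding g_def g'_def G_def
    by (intro has_lf_deriv_imp_DERIV_base)
      (auto simp: lf_differentiable_on_def, meson atLeastAtMost_iff has_lf_deriv_lf_deriv subsetD)
  have g: "continuous_on {a..b} g"
    by (rule continuous_at_imp_continuous_on) (use deriv DERIV_isCont in blast)
  have g': "continuous_on {a..b} g'"
    unfolding g'_def by (rule lf_cont_on_imp_continuous_on_base) fact
  \<comment> \<open>The prefactor \<open>\<Gamma>(1 + \<alpha>)\<close> in the statement cancels the division by \<open>G\<close> here; for the integral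
    with \<open>S\<close> below, the \<open>G\<close> is absorbed by \<open>g'\<close>, which is \<open>G\<close> times the derivative of \<open>g\<close>.\<close>
  have int_f: "lf_integral \<alpha> a b f = apow (integral {a..b} g / G)"
    using left_sum_continuous_tendsto_integral[OF \<open>a < b\<close> g] \<open>a < b\<close>
    unfolding G_def g_def by (intro lf_integral_eq)
  define J where "J = integral {a..m} (\<lambda>x. (x - a) * g' x) + integral {m..b} (\<lambda>x. (x - b) * g' x)"
  have "base (S_kernel a b x * lf_deriv \<alpha> f x) =
      (if x < m then (x - a) * g' x else (x - b) * g' x)" for x
    by (simp add: S_kernel_def ralpha_defs m_def g'_def)
  moreover have "(left_sum (\<lambda>x. if x < m then (x - a) * g' x else (x - b) * g' x) \<longlongrightarrow> J)
      (fine_partitions a b)"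
    unfolding J_def using m
    by (intro left_sum_piecewise_tendsto continuous_intros continuous_on_subset[OF g']) auto
  ultimately have int_S: "lf_integral \<alpha> a b (\<lambda>x. S_kernel a b x * lf_deriv \<alpha> f x) = apow (J / G)"
    using \<open>a < b\<close> unfolding G_def by (intro lf_integral_eq) auto
  have "J / G = (b - a) * g m - integral {a..b} g"
    using midpoint_identity[of a m b g "\<lambda>x. g' x / G"] m deriv g' \<open>G > 0\<close>
    by (simp add: J_def add_divide_distrib continuous_on_divide)
  moreover have "of_real G = apow G"
    by (simp add: of_real_def scaleR_ralpha_def one_ralpha_def)
  ultimately show ?thesis
    using \<open>a < b\<close> \<open>G > 0\<close>
    unfolding int_f int_S G_def[symmetric] m_def[symmetric]
    by (simp add: ralpha_defs base_inject[symmetric] g_def field_simps)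
qed

end
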